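(* Let $f:\mathbb R^d\to\mathbb R$ be $\beta$-smooth with $f(x)-f(y)\le M$ for all $x,y\in\mathbb R^d$, and suppose the stochastic gradient oracle $\mathcal O$ is unbiased with variance at most $\sigma^2$ (in the sense given in the context). If the online-to-nonconvex conversion algorithm described in the context is run for $T$ iterations with online convex optimization oracle $\mathcal A$, then its trajectory $x_1,\dots,x_T$ satisfies $$\frac1T\sum_{t=1}^T\mathbb E\big[\|\nabla f(x_t)\|_2^2\big]\le \frac{101\,\sigma\sqrt{M\beta}}{\sqrt T}+\frac{8192}{5951}\,\frac{\sqrt{M\beta}\,\mathscr R_T(\mathcal A,I_d)}{T}+\frac{97\,M\beta}{T}.$$
   Context: **Function.** $f:\mathbb R^d\to\mathbb R$ is differentiable, $\beta$-smooth means $\|\nabla f(x)-\nabla f(y)\|_2\le\beta\|x-y\|_2$ for all $x,y$ ($\beta>0$), and $M>0$. **Stochastic gradient oracle.** Each query $\mathcal O(x)$ returns a fresh random vector $\widetilde\nabla f(x)$ with $\mathbb E[\widetilde\nabla f(x)\mid x]=\nabla f(x)$ and $\mathbb E[\|\widetilde\nabla f(x)-\nabla f(x)\|_2^2\mid x]\le\sigma^2$ ($\sigma\ge0$). Freshness means that the sample $s_t$ drawn at $x_t$ in the algorithm below satisfies $\mathbb E[s_t\mid\mathcal H_t]=\nabla f(x_t)$ and $\mathbb E[\|s_t-\nabla f(x_t)\|_2^2\mid\mathcal H_t]\le\sigma^2$, where $\mathcal H_t$ is the $\sigma$-algebra generated by everything produced before $s_t$ is drawn (including $x_t,m_t,U_t$).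 **Decision sets.** For each $t$, $\mathcal U_t$ is a nonempty compact convex set of real symmetric $d\times d$ matrices with $\|U\|_{\mathrm{op}}\le1$ for all $U\in\mathcal U_t$. The sets $\mathcal U_t$ are not required to contain the identity $I_d$. **OCO oracle.** $\mathcal A$ is any (possibly randomized) online algorithm which at each round $t$ chooses $U_t\in\mathcal U_t$ on the basis of the past (losses $L_1,\dots,L_{t-1}$), before the current loss $L_t$ (hence $s_t$) is revealed. **Algorithm.** Given an arbitrary initial point $x_1\in\mathbb R^d$, set $G=\sqrt{M\beta}$, $G_0=\sqrt{2M\beta}$, $\mathbb B_0=\{v\in\mathbb R^d:\|v\|_2\le G_0\}$, $a=\dfrac{G}{\max\{G,\sigma\sqrt T\}}$, $\eta=\dfrac{a}{64\beta}$, $m_1=0$. For $t=1,\dots,T$: (1) $\mathcal A$ chooses $U_t\in\mathcal U_t$; (2) draw a fresh sample $s_t\sim\mathcal O(x_t)$; (3) reveal to $\mathcal A$ the linear loss $L_t(U)=-\frac1G\langle s_t,Um_t\rangle$; (4) $x_{t+1}=x_t-\eta U_tm_t$; (5) $m_{t+1}=\Pi_{\mathbb B_0}((1-a)m_t+as_t)$, where $\Pi_{\mathbb B_0}$ is Euclidean projection onto $\mathbb B_0$. **Expected static regret.** $\mathscr R_T(\mathcal A,I_d)=\mathbb E\big[\sum_{t=1}^TL_t(U_t)-\sum_{t=1}^TL_t(I_d)\big]$, where the expectation is over all randomness (of $\mathcal A$ and of the stochastic gradients). It may be positive, zero or negative. *)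

theory Defs
  imports "HOL-Probability.Probability"
begin

definition grad :: "('a::real_inner \<Rightarrow> real) \<Rightarrow> 'a \<Rightarrow> 'a" where
  "grad f x = (THE D. GDERIV f x :> D)"

definition smooth :: "real \<Rightarrow> ('a::real_inner \<Rightarrow> real) \<Rightarrow> bool" where
  "smooth \<beta> f \<longleftrightarrow> (\<forall>x. f differentiable (at x)) \<and>
     (\<forall>x y. norm (grad f x - grad f y) \<le> \<beta> * norm (x - y))"

definition decision_set :: "(real^'n^'n) set \<Rightarrow> bool" where
  "decision_set K \<longleftrightarrow> K \<noteq> {} \<and> compact K \<and> convex K \<and>
     (\<forall>W\<in>K. transpose W = W \<and> onorm ((*v) W) \<le> 1)"

text \<open>Algorithm parameters: \<open>M\<close> bounds the range of the objective, \<open>T\<close> is the number of rounds.\<close>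

definition par_G :: "real \<Rightarrow> real \<Rightarrow> real" where
  "par_G M \<beta> = sqrt (M * \<beta>)"

definition par_G0 :: "real \<Rightarrow> real \<Rightarrow> real" where
  "par_G0 M \<beta> = sqrt (2 * M * \<beta>)"

definition par_a :: "real \<Rightarrow> real \<Rightarrow> real \<Rightarrow> nat \<Rightarrow> real" where
  "par_a M \<beta> \<sigma> T = par_G M \<beta> / max (par_G M \<beta>) (\<sigma> * sqrt (real T))"

definition par_eta :: "real \<Rightarrow> real \<Rightarrow> real \<Rightarrow> nat \<Rightarrow> real" where
  "par_eta M \<beta> \<sigma> T = par_a M \<beta> \<sigma> T / (64 * \<beta>)"

definition lin_loss :: "real \<Rightarrow> real \<Rightarrow> real^'n \<Rightarrow> real^'n \<Rightarrow> real^'n^'n \<Rightarrow> real" where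
  "lin_loss M \<beta> s m W = - (1 / par_G M \<beta>) * (s \<bullet> (W *v m))"

text \<open>
  One realization of the algorithm (rounds are numbered from 1). A randomized online algorithm is
  a function \<open>\<A>\<close> from the list of internal random draws \<open>\<rho> 1, \<dots>, \<rho> t\<close> made so far and the list of
  revealed loss functions \<open>L\<^sub>1, \<dots>, L\<^sub>t\<^sub>-\<^sub>1\<close> to its choice in round \<open>t\<close>.
\<close>

definition conversion_run ::
  "real \<Rightarrow> real \<Rightarrow> real \<Rightarrow> nat \<Rightarrow> (nat \<Rightarrow> (real^'n^'n) set) \<Rightarrow>
   ('r list \<Rightarrow> (real^'n^'n \<Rightarrow> real) list \<Rightarrow> real^'n^'n) \<Rightarrow> real^'n \<Rightarrow>
   (nat \<Rightarrow> 'r) \<Rightarrow> (nat \<Rightarrow> real^'n) \<Rightarrow>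
   (nat \<Rightarrow> real^'n) \<Rightarrow> (nat \<Rightarrow> real^'n) \<Rightarrow> (nat \<Rightarrow> real^'n^'n) \<Rightarrow> bool" where
  "conversion_run M \<beta> \<sigma> T \<U> \<A> x1 \<rho> s x m U \<longleftrightarrow>
     x 1 = x1 \<and> m 1 = 0 \<and>
     (\<forall>t\<in>{1..T}.
        U t = \<A> (map \<rho> [1..<t + 1]) (map (\<lambda>i. lin_loss M \<beta> (s i) (m i)) [1..<t]) \<and>
        U t \<in> \<U> t \<and>
        x (t + 1) = x t - par_eta M \<beta> \<sigma> T *\<^sub>R (U t *v m t) \<and>
        m (t + 1) = closest_point (cball 0 (par_G0 M \<beta>))
                      ((1 - par_a M \<beta> \<sigma> T) *\<^sub>R m t + par_a M \<beta> \<sigma> T *\<^sub>R s t))"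

definition events_of :: "'w measure \<Rightarrow> 'b measure \<Rightarrow> ('w \<Rightarrow> 'b) \<Rightarrow> 'w set set" where
  "events_of P N X = {X -` B \<inter> space P | B. B \<in> sets N}"

text \<open>Everything produced before \<open>s t\<close> is drawn, including the internal randomness used so far.\<close>

definition history ::
  "'w measure \<Rightarrow> 'r measure \<Rightarrow> (nat \<Rightarrow> 'w \<Rightarrow> 'r) \<Rightarrow> (nat \<Rightarrow> 'w \<Rightarrow> real^'n) \<Rightarrow>
   (nat \<Rightarrow> 'w \<Rightarrow> real^'n) \<Rightarrow> (nat \<Rightarrow> 'w \<Rightarrow> real^'n) \<Rightarrow> (nat \<Rightarrow> 'w \<Rightarrow> real^'n^'n) \<Rightarrow>
   nat \<Rightarrow> 'w measure" where
  "history P R \<rho> s x m U t = sigma (space P)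
     ((\<Union>i\<in>{1..t}. events_of P R (\<rho> i) \<union> events_of P borel (x i) \<union>
                    events_of P borel (m i) \<union> events_of P borel (U i)) \<union>
      (\<Union>i\<in>{1..<t}. events_of P borel (s i)))"

text \<open>
  Integrability of \<open>S\<close> is what makes its conditional expectation meaningful: \<open>real_cond_exp\<close> is a
  total function without a specified value on other functions. The second moment is expressed by
  the conditional expectation of nonnegative functions, which needs no integrability.
\<close>

definition unbiased_bounded_variance ::
  "'w measure \<Rightarrow> 'w measure \<Rightarrow> real \<Rightarrow> ('w \<Rightarrow> real^'n) \<Rightarrow> ('w \<Rightarrow> real^'n) \<Rightarrow> bool" where
  "unbiased_bounded_variance P F \<sigma> S g \<longleftrightarrow>
     integrable P S \<and>
     (AE \<omega> in P. \<forall>i. real_cond_exp P F (\<lambda>\<omega>'. S \<omega>' $ i) \<omega> = g \<omega> $ i) \<and>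
     (AE \<omega> in P. nn_cond_exp P F (\<lambda>\<omega>'. ennreal ((norm (S \<omega>' - g \<omega>'))\<^sup>2)) \<omega> \<le> ennreal (\<sigma>\<^sup>2))"

definition expected_regret ::
  "'w measure \<Rightarrow> real \<Rightarrow> real \<Rightarrow> nat \<Rightarrow> (nat \<Rightarrow> 'w \<Rightarrow> real^'n) \<Rightarrow> (nat \<Rightarrow> 'w \<Rightarrow> real^'n) \<Rightarrow>
   (nat \<Rightarrow> 'w \<Rightarrow> real^'n^'n) \<Rightarrow> real^'n^'n \<Rightarrow> real" where
  "expected_regret P M \<beta> T s m U V =
     (\<integral>\<omega>. (\<Sum>t=1..T. lin_loss M \<beta> (s t \<omega>) (m t \<omega>) (U t \<omega>))
          - (\<Sum>t=1..T. lin_loss M \<beta> (s t \<omega>) (m t \<omega>) V) \<partial>P)"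

end

theory Submission
  imports Defs
begin

text \<open>
  Write \<open>g\<^sub>t = \<nabla>f(x\<^sub>t)\<close>, \<open>e\<^sub>t = m\<^sub>t - g\<^sub>t\<close>, and \<open>S\<^sub>g\<close>, \<open>S\<^sub>m\<close>, \<open>S\<^sub>e\<close> for the sums over
  \<open>t \<le> T\<close> of the second moments of \<open>g\<^sub>t\<close>, \<open>m\<^sub>t\<close>, \<open>e\<^sub>t\<close>. Since \<open>s\<^sub>t\<close> is conditionally unbiased and
  \<open>U\<^sub>t m\<^sub>t\<close> and \<open>m\<^sub>t\<close> belong to the history, \<open>G\<close> times the regret is the expectation of
  \<open>\<Sum>\<langle>g\<^sub>t, m\<^sub>t\<rangle> - \<Sum>\<langle>g\<^sub>t, U\<^sub>t m\<^sub>t\<rangle>\<close>. The descent lemma bounds the second sum by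
  \<open>M/\<eta> + (\<beta>\<eta>/2) S\<^sub>m\<close>, and \<open>2\<langle>g\<^sub>t, m\<^sub>t\<rangle> = |g\<^sub>t|\<^sup>2 + |m\<^sub>t|\<^sup>2 - |e\<^sub>t|\<^sup>2\<close>, which gives
  \<open>S\<^sub>g + S\<^sub>m - S\<^sub>e \<le> 2M/\<eta> + \<beta>\<eta> S\<^sub>m + 2GR\<close>. All gradients lie in the ball onto which the momentum
  is projected, so projecting does not increase the error, and conditioning on the history gives
  \<open>E|e\<^sub>t\<^sub>+\<^sub>1|\<^sup>2 \<le> (1-a) E|e\<^sub>t|\<^sup>2 + (a/4096) E|m\<^sub>t|\<^sup>2 + a\<^sup>2\<sigma>\<^sup>2\<close>; summing bounds \<open>S\<^sub>e\<close>. The regret may be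
  negative, so its coefficient must come out exactly: the remaining share of \<open>S\<^sub>g\<close> is taken from
  \<open>S\<^sub>g \<le> 2S\<^sub>m + 2S\<^sub>e\<close> instead of weighting the first inequality more.
\<close>

section \<open>Smooth functions\<close>

text \<open>The derivative is a linear functional, represented by its adjoint at \<open>1\<close>.
  Derivatives are unique, so the description in \<open>grad\<close> picks out exactly this
  vector.\<close>

lemma GDERIV_grad:
  fixes f :: "'a::euclidean_space \<Rightarrow> real"
  assumes "f differentiable (at x)"
  shows "GDERIV f x :> grad f x"
proof -
  obtain D where D: "(f has_derivative D) (at x)"
    using assms by (auto simp: differentiable_def)
  then have lin: "linear D" by (rule has_derivative_linear)
  have "D = (\<lambda>h. h \<bullet> adjoint D (1::real))"
    using adjoint_works[OF lin, of _ "1::real"] by (auto simp: inner_commute)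
  then have G: "GDERIV f x :> adjoint D 1" using D by (simp add: gderiv_def)
  have "D' = adjoint D 1" if "GDERIV f x :> D'" for D'
  proof -
    have "(\<lambda>h. h \<bullet> D') = (\<lambda>h. h \<bullet> adjoint D (1::real))"
      using has_derivative_unique that G unfolding gderiv_def by blast
    then show ?thesis by (metis vector_eq_rdot inner_commute)
  qed
  with G show ?thesis unfolding grad_def by (rule theI)
qed

text \<open>Restrict \<open>f\<close> to the segment from \<open>z\<close> to \<open>z + d\<close>
  and subtract the quadratic model. By Cauchy-Schwarz and the Lipschitz gradient, the difference
  \<open>\<phi>\<close> has nonpositive derivative on the unit interval.\<close>

lemma smooth_descent:
  fixes f :: "'a::euclidean_space \<Rightarrow> real"
  assumes sm: "smooth \<beta> f"
  shows "f (z + d) \<le> f z + grad f z \<bullet> d + \<beta> / 2 * (norm d)\<^sup>2"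
proof -
  define \<phi> where "\<phi> u = f (z + u *\<^sub>R d) - u * (grad f z \<bullet> d) - \<beta> / 2 * u\<^sup>2 * (norm d)\<^sup>2" for u :: real
  have "\<phi> 1 \<le> \<phi> 0"
  proof (rule DERIV_nonpos_imp_nonincreasing[of 0 1 \<phi>])
    fix u :: real assume u: "0 \<le> u" "u \<le> 1"
    let ?D = "grad f (z + u *\<^sub>R d) \<bullet> d - grad f z \<bullet> d - \<beta> * u * (norm d)\<^sup>2"
    have f': "(f has_derivative (\<lambda>h. h \<bullet> grad f y)) (at y)" for y
      using GDERIV_grad[of f y] sm by (simp add: smooth_def gderiv_def)
    have "((\<lambda>u. f (z + u *\<^sub>R d)) has_derivative (\<lambda>h. (h *\<^sub>R d) \<bullet> grad f (z + u *\<^sub>R d))) (at u)"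
      by (rule has_derivative_compose[OF _ f']) (auto intro!: derivative_eq_intros)
    then have "((\<lambda>u. f (z + u *\<^sub>R d)) has_real_derivative grad f (z + u *\<^sub>R d) \<bullet> d) (at u)"
      by (simp add: has_field_derivative_def inner_commute mult_commute_abs)
    then have "(\<phi> has_real_derivative ?D) (at u)"
      unfolding \<phi>_def by (auto intro!: derivative_eq_intros)
    moreover have "?D \<le> 0"
    proof -
      have lip: "norm (grad f (z + u *\<^sub>R d) - grad f z) \<le> \<beta> * norm ((z + u *\<^sub>R d) - z)"
        using sm unfolding smooth_def by blast
      have "(grad f (z + u *\<^sub>R d) - grad f z) \<bullet> d \<le> norm (grad f (z + u *\<^sub>R d) - grad f z) * norm d"
        by (rule norm_cauchy_schwarz)
      also have "\<dots> \<le> (\<beta> * norm ((z + u *\<^sub>R d) - z)) * norm d"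
        by (rule mult_right_mono[OF lip norm_ge_zero])
      finally show ?thesis using u by (simp add: power2_eq_square inner_diff_left mult.assoc)
    qed
    ultimately show "\<exists>y. (\<phi> has_real_derivative y) (at u) \<and> y \<le> 0" by blast
  qed simp
  then show ?thesis by (simp add: \<phi>_def)
qed

text \<open>A gradient step of length \<open>1/\<beta>\<close> lowers \<open>f\<close> by at least
  \<open>(norm (grad f z))\<^sup>2 / (2 * \<beta>)\<close>, and no decrease can exceed
  \<open>M\<close>.\<close>

lemma norm_grad_le:
  fixes f :: "'a::euclidean_space \<Rightarrow> real"
  assumes sm: "smooth \<beta> f" and "\<beta> > 0" and range: "\<And>y z. f y - f z \<le> M"
  shows "(norm (grad f z))\<^sup>2 \<le> 2 * M * \<beta>"
proof -
  let ?g = "grad f z"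
  have "f (z + (- (1/\<beta>)) *\<^sub>R ?g) \<le> f z - (norm ?g)\<^sup>2 / (2 * \<beta>)"
    using smooth_descent[OF sm, of z "(- (1/\<beta>)) *\<^sub>R ?g"] \<open>\<beta> > 0\<close>
    by (simp add: power2_norm_eq_inner[symmetric] field_simps power2_eq_square)
  then have "(norm ?g)\<^sup>2 / (2 * \<beta>) \<le> M"
    using range[of z "z + (- (1/\<beta>)) *\<^sub>R ?g"] by linarith
  then show ?thesis using \<open>\<beta> > 0\<close> by (simp add: field_simps)
qed

lemma continuous_on_grad:
  fixes f :: "'a::euclidean_space \<Rightarrow> real"
  assumes "smooth \<beta> f" "\<beta> > 0"
  shows "continuous_on A (grad f)"
proof -
  have "\<beta>-lipschitz_on A (grad f)"
    using assms by (intro lipschitz_onI) (auto simp: smooth_def dist_norm)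
  then show ?thesis by (rule lipschitz_on_continuous_on)
qed

section \<open>Norm inequalities and measurability\<close>

lemma inner_eq_norm_sq_diff:
  fixes u v :: "'a::real_inner"
  shows "2 * (u \<bullet> v) = (norm u)\<^sup>2 + (norm v)\<^sup>2 - (norm (v - u))\<^sup>2"
  unfolding power2_norm_eq_inner by (simp add: inner_diff_left inner_diff_right inner_commute)

lemma norm_sq_le_twice:
  fixes u v :: "'a::real_inner"
  shows "(norm u)\<^sup>2 \<le> 2 * (norm v)\<^sup>2 + 2 * (norm (v - u))\<^sup>2"
proof -
  have "2 * (norm v)\<^sup>2 + 2 * (norm (v - u))\<^sup>2 - (norm u)\<^sup>2 = (norm (2 *\<^sub>R v - u))\<^sup>2"
    unfolding power2_norm_eq_inner
    by (simp add: inner_diff_left inner_diff_right inner_commute algebra_simps)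
  then show ?thesis by (smt (verit) zero_le_power2)
qed

text \<open>Convexity of the squared norm, with \<open>d\<close> written as \<open>a\<close> times
  \<open>d / a\<close>. For a perturbation \<open>d\<close> of order \<open>a\<close>, the last term
  is again of order \<open>a\<close>, so the contraction by \<open>1 - a\<close> is not
  lost.\<close>

lemma norm_convex_combination_sq_le:
  fixes u d :: "'a::real_inner"
  assumes "0 < a" "a \<le> 1"
  shows "(norm ((1 - a) *\<^sub>R u + d))\<^sup>2 \<le> (1 - a) * (norm u)\<^sup>2 + (norm d)\<^sup>2 / a"
proof -
  define v where "v = (1 / a) *\<^sub>R d"
  have d: "d = a *\<^sub>R v" using assms by (simp add: v_def)
  have "(norm ((1 - a) *\<^sub>R u + a *\<^sub>R v))\<^sup>2 = (1 - a) * (norm u)\<^sup>2 + a * (norm v)\<^sup>2 - a * (1 - a) * (norm (u - v))\<^sup>2"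
    unfolding power2_norm_eq_inner
    by (simp add: inner_simps inner_commute algebra_simps)
  also have "\<dots> \<le> (1 - a) * (norm u)\<^sup>2 + a * (norm v)\<^sup>2"
    using assms by simp
  finally show ?thesis using assms by (simp add: d power_mult_distrib power2_eq_square mult_ac)
qed

lemma borel_measurable_matrix_vector_mult [measurable (raw)]:
  fixes A :: "'w \<Rightarrow> real^'n^'k" and v :: "'w \<Rightarrow> real^'n"
  assumes "A \<in> borel_measurable N" "v \<in> borel_measurable N"
  shows "(\<lambda>\<omega>. A \<omega> *v v \<omega>) \<in> borel_measurable N"
proof (rule borel_measurable_continuous_Pair[OF assms])
  show "continuous_on UNIV (\<lambda>p :: (real^'n^'k) \<times> (real^'n). fst p *v snd p)"
    unfolding matrix_vector_mult_def
    by (intro continuous_on_vec_lambda) (auto intro!: continuous_intros)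
qed

lemma borel_measurable_vec_nth [measurable (raw)]:
  fixes v :: "'w \<Rightarrow> real^'n"
  assumes "v \<in> borel_measurable N"
  shows "(\<lambda>\<omega>. v \<omega> $ i) \<in> borel_measurable N"
  using assms by (rule borel_measurable_continuous_on[rotated]) (auto intro!: continuous_intros)

lemma (in prob_space) integrable_norm_sq:
  fixes h :: "'a \<Rightarrow> 'b::euclidean_space"
  assumes [measurable]: "h \<in> borel_measurable M" and "\<And>\<omega>. \<omega> \<in> space M \<Longrightarrow> norm (h \<omega>) \<le> B"
  shows "integrable M (\<lambda>\<omega>. (norm (h \<omega>))\<^sup>2)"
  by (rule integrable_const_bound[where B="B\<^sup>2"]) (use assms in \<open>auto intro!: AE_I2 power_mono\<close>)

lemma (in prob_space) integrable_inner_bounded: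
  fixes h k :: "'a \<Rightarrow> 'b::euclidean_space"
  assumes [measurable]: "h \<in> borel_measurable M" "k \<in> borel_measurable M"
    and h_le: "\<And>\<omega>. \<omega> \<in> space M \<Longrightarrow> norm (h \<omega>) \<le> B" and k_le: "\<And>\<omega>. \<omega> \<in> space M \<Longrightarrow> norm (k \<omega>) \<le> C"
  shows "integrable M (\<lambda>\<omega>. h \<omega> \<bullet> k \<omega>)"
proof (rule integrable_const_bound[where B="B * C"])
  show "AE \<omega> in M. norm (h \<omega> \<bullet> k \<omega>) \<le> B * C"
  proof (rule AE_I2)
    fix \<omega> assume w: "\<omega> \<in> space M"
    have "norm (h \<omega> \<bullet> k \<omega>) \<le> norm (h \<omega>) * norm (k \<omega>)"
      using Cauchy_Schwarz_ineq2 by simp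
    also have "\<dots> \<le> B * C"
      using h_le[OF w] k_le[OF w] by (intro mult_mono) (auto intro: order_trans[OF norm_ge_zero])
    finally show "norm (h \<omega> \<bullet> k \<omega>) \<le> B * C" .
  qed
qed measurable

section \<open>Conditionally unbiased noise\<close>

text \<open>A single round in isolation: \<open>F\<close> stands for the history, \<open>S\<close>
  for the fresh sample and \<open>g\<close> for the true gradient at the current point.\<close>

context
  fixes P F :: "'w measure" and \<sigma> :: real and S g :: "'w \<Rightarrow> real^'n" and C :: real
  assumes prob: "prob_space P" and sub: "subalgebra P F"
    and unb: "unbiased_bounded_variance P F \<sigma> S g"
    and meas_g: "g \<in> borel_measurable P" and g_le: "\<And>\<omega>. \<omega> \<in> space P \<Longrightarrow> norm (g \<omega>) \<le> C"
begin

lemma finite_subalgebra: "finite_measure_subalgebra P F"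
  using prob sub by (simp add: finite_measure_subalgebra_def finite_measure_subalgebra_axioms_def
    prob_space.finite_measure)

text \<open>Integrating the nonnegative conditional expectation against the weight \<open>1\<close>
  removes the conditioning. The resulting finite bound also yields square integrability.\<close>

lemma noise_variance:
  shows noise_square_integrable: "integrable P (\<lambda>\<omega>. (norm (S \<omega> - g \<omega>))\<^sup>2)"
    and noise_variance_le: "(\<integral>\<omega>. (norm (S \<omega> - g \<omega>))\<^sup>2 \<partial>P) \<le> \<sigma>\<^sup>2"
proof -
  interpret finite_measure_subalgebra P F by (rule finite_subalgebra)
  interpret prob_space P by (rule prob)
  have [measurable]: "S \<in> borel_measurable P" "g \<in> borel_measurable P"
    using unb meas_g by (auto simp: unbiased_bounded_variance_def)
  let ?q = "\<lambda>\<omega>. ennreal ((norm (S \<omega> - g \<omega>))\<^sup>2)"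
  have "(\<integral>\<^sup>+\<omega>. ?q \<omega> \<partial>P) = (\<integral>\<^sup>+\<omega>. nn_cond_exp P F ?q \<omega> \<partial>P)"
    using nn_cond_exp_intg[of "\<lambda>_. 1" ?q] by simp
  also have "\<dots> \<le> (\<integral>\<^sup>+\<omega>. ennreal (\<sigma>\<^sup>2) \<partial>P)"
    using unb by (intro nn_integral_mono_AE) (simp add: unbiased_bounded_variance_def)
  also have "\<dots> = ennreal (\<sigma>\<^sup>2)" by (simp add: emeasure_space_1)
  finally have le: "(\<integral>\<^sup>+\<omega>. ?q \<omega> \<partial>P) \<le> ennreal (\<sigma>\<^sup>2)" .
  show int: "integrable P (\<lambda>\<omega>. (norm (S \<omega> - g \<omega>))\<^sup>2)"
    using le by (intro integrableI_bounded) (auto intro: le_less_trans)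
  show "(\<integral>\<omega>. (norm (S \<omega> - g \<omega>))\<^sup>2 \<partial>P) \<le> \<sigma>\<^sup>2"
    using le nn_integral_eq_integral[OF int] by simp
qed

lemma integrable_inner_sample:
  assumes [measurable]: "h \<in> borel_measurable P" and h_le: "\<And>\<omega>. \<omega> \<in> space P \<Longrightarrow> norm (h \<omega>) \<le> B"
  shows "integrable P (\<lambda>\<omega>. h \<omega> \<bullet> S \<omega>)"
proof -
  have S: "integrable P S" using unb by (simp add: unbiased_bounded_variance_def)
  then have [measurable]: "S \<in> borel_measurable P" by simp
  show ?thesis
  proof (rule Bochner_Integration.integrable_bound)
    show "integrable P (\<lambda>\<omega>. B * norm (S \<omega>))" using S by simp
    show "AE \<omega> in P. norm (h \<omega> \<bullet> S \<omega>) \<le> norm (B * norm (S \<omega>))"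
    proof (rule AE_I2)
      fix \<omega> assume "\<omega> \<in> space P"
      then have "norm (h \<omega>) * norm (S \<omega>) \<le> B * norm (S \<omega>)"
        by (intro mult_right_mono h_le) auto
      then show "norm (h \<omega> \<bullet> S \<omega>) \<le> norm (B * norm (S \<omega>))"
        using Cauchy_Schwarz_ineq2[of "h \<omega>" "S \<omega>"] by simp
    qed
  qed measurable
qed

text \<open>Each coordinate of \<open>h\<close> is \<open>F\<close>-measurable, so it can be moved
  out of the conditional expectation of the same coordinate of \<open>S\<close>, which equals that
  of \<open>g\<close> almost everywhere.\<close>

lemma integral_inner_sample:
  assumes meas_h: "h \<in> borel_measurable F" and h_le: "\<And>\<omega>. \<omega> \<in> space P \<Longrightarrow> norm (h \<omega>) \<le> B"
  shows "(\<integral>\<omega>. h \<omega> \<bullet> S \<omega> \<partial>P) = (\<integral>\<omega>. h \<omega> \<bullet> g \<omega> \<partial>P)"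
proof -
  interpret finite_measure_subalgebra P F by (rule finite_subalgebra)
  have S: "integrable P S" using unb by (simp add: unbiased_bounded_variance_def)
  have meas[measurable]: "S \<in> borel_measurable P" "g \<in> borel_measurable P" "h \<in> borel_measurable F"
    using S meas_g meas_h by auto
  have [measurable]: "h \<in> borel_measurable P"
    using measurable_from_subalg[OF sub meas_h] .
  have int: "integrable P (\<lambda>\<omega>. h \<omega> $ i * S \<omega> $ i)" for i
  proof -
    \<comment> \<open>A single coordinate product is the inner product of \<open>S\<close> with a
      bounded multiple of a basis vector, so the vector statement applies.\<close>
    have "integrable P (\<lambda>\<omega>. (h \<omega> $ i *\<^sub>R axis i 1) \<bullet> S \<omega>)"
      using h_le by (intro integrable_inner_sample[where B=B])
        (auto intro: order_trans[OF component_le_norm_cart])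
    then show ?thesis by (simp add: inner_axis')
  qed
  have intg: "(\<integral>\<omega>. h \<omega> $ i * S \<omega> $ i \<partial>P) = (\<integral>\<omega>. h \<omega> $ i * g \<omega> $ i \<partial>P)"
    and int': "integrable P (\<lambda>\<omega>. h \<omega> $ i * g \<omega> $ i)" for i
  proof -
    let ?c = "real_cond_exp P F (\<lambda>\<omega>. S \<omega> $ i)"
    have ae: "AE \<omega> in P. h \<omega> $ i * ?c \<omega> = h \<omega> $ i * g \<omega> $ i"
      using unb by (auto simp: unbiased_bounded_variance_def)
    have m: "(\<lambda>\<omega>. h \<omega> $ i) \<in> borel_measurable F" "(\<lambda>\<omega>. S \<omega> $ i) \<in> borel_measurable P" by measurable
    show "(\<integral>\<omega>. h \<omega> $ i * S \<omega> $ i \<partial>P) = (\<integral>\<omega>. h \<omega> $ i * g \<omega> $ i \<partial>P)"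
      using real_cond_exp_intg(2)[OF int m] integral_cong_AE[OF _ _ ae] by simp
    show "integrable P (\<lambda>\<omega>. h \<omega> $ i * g \<omega> $ i)"
      using real_cond_exp_intg(1)[OF int m] integrable_cong_AE[OF _ _ ae] by simp
  qed
  show ?thesis
    using int int' by (simp add: inner_vec_def intg)
qed

text \<open>In the expanded square the cross term has mean zero, because \<open>h\<close> is
  \<open>F\<close>-measurable and the noise is conditionally centred. Hence the noise contributes
  only its variance times \<open>a\<^sup>2\<close>.\<close>

lemma integral_add_noise_sq_le:
  assumes meas_h: "h \<in> borel_measurable F" and h_le: "\<And>\<omega>. \<omega> \<in> space P \<Longrightarrow> norm (h \<omega>) \<le> B"
  shows "integrable P (\<lambda>\<omega>. (norm (h \<omega> + a *\<^sub>R (S \<omega> - g \<omega>)))\<^sup>2)"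
    and "(\<integral>\<omega>. (norm (h \<omega> + a *\<^sub>R (S \<omega> - g \<omega>)))\<^sup>2 \<partial>P) \<le> (\<integral>\<omega>. (norm (h \<omega>))\<^sup>2 \<partial>P) + a\<^sup>2 * \<sigma>\<^sup>2"
proof -
  interpret prob_space P by (rule prob)
  have [measurable]: "h \<in> borel_measurable P"
    using measurable_from_subalg[OF sub meas_h] .
  have [measurable]: "g \<in> borel_measurable P" by (rule meas_g)
  have hh: "integrable P (\<lambda>\<omega>. (norm (h \<omega>))\<^sup>2)"
    by (rule integrable_norm_sq[OF _ h_le]) measurable
  have hg: "integrable P (\<lambda>\<omega>. h \<omega> \<bullet> g \<omega>)"
    by (rule integrable_inner_bounded[OF _ _ h_le g_le]) measurable
  have hS: "integrable P (\<lambda>\<omega>. h \<omega> \<bullet> S \<omega>)"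
    by (rule integrable_inner_sample[where B=B]) (use h_le in auto)
  have eq: "(norm (h \<omega> + a *\<^sub>R (S \<omega> - g \<omega>)))\<^sup>2 =
      (norm (h \<omega>))\<^sup>2 + 2 * a * (h \<omega> \<bullet> S \<omega> - h \<omega> \<bullet> g \<omega>) + a\<^sup>2 * (norm (S \<omega> - g \<omega>))\<^sup>2" for \<omega>
    unfolding power2_norm_eq_inner
    by (simp add: inner_simps inner_commute algebra_simps power2_eq_square)
  show "integrable P (\<lambda>\<omega>. (norm (h \<omega> + a *\<^sub>R (S \<omega> - g \<omega>)))\<^sup>2)"
    unfolding eq using hh hg hS noise_square_integrable by simp
  have "(\<integral>\<omega>. (norm (h \<omega> + a *\<^sub>R (S \<omega> - g \<omega>)))\<^sup>2 \<partial>P) =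
      (\<integral>\<omega>. (norm (h \<omega>))\<^sup>2 \<partial>P) + a\<^sup>2 * (\<integral>\<omega>. (norm (S \<omega> - g \<omega>))\<^sup>2 \<partial>P)"
    unfolding eq using hh hg hS noise_square_integrable integral_inner_sample[OF meas_h h_le]
    by simp
  then show "(\<integral>\<omega>. (norm (h \<omega> + a *\<^sub>R (S \<omega> - g \<omega>)))\<^sup>2 \<partial>P) \<le> (\<integral>\<omega>. (norm (h \<omega>))\<^sup>2 \<partial>P) + a\<^sup>2 * \<sigma>\<^sup>2"
    using noise_variance_le by (simp add: mult_left_mono)
qed

end


section \<open>The run of the conversion algorithm\<close>

lemma events_of_subset_sets: "X \<in> measurable N K \<Longrightarrow> events_of N K X \<subseteq> sets N"
  by (auto simp: events_of_def)

lemma decision_set_norm_le: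
  assumes "decision_set K" "W \<in> K"
  shows "norm (W *v v) \<le> norm v"
proof -
  have "norm (W *v v) \<le> onorm ((*v) W) * norm v"
    by (intro onorm matrix_vector_mul_bounded_linear)
  also have "\<dots> \<le> 1 * norm v"
    using assms by (intro mult_right_mono) (auto simp: decision_set_def)
  finally show ?thesis by simp
qed

locale conversion = prob_space P
  for P :: "'w measure" +
  fixes f :: "real^'n \<Rightarrow> real" and \<beta> M \<sigma> :: real and T :: nat
    and \<U> :: "nat \<Rightarrow> (real^'n^'n) set"
    and \<A> :: "'r list \<Rightarrow> (real^'n^'n \<Rightarrow> real) list \<Rightarrow> real^'n^'n"
    and R :: "'r measure" and \<rho> :: "nat \<Rightarrow> 'w \<Rightarrow> 'r"
    and s x m :: "nat \<Rightarrow> 'w \<Rightarrow> real^'n" and U :: "nat \<Rightarrow> 'w \<Rightarrow> real^'n^'n"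
    and x1 :: "real^'n"
  assumes \<beta>: "\<beta> > 0" and M: "M > 0" and \<sigma>: "\<sigma> \<ge> 0" and T: "T \<ge> 1"
    and smooth_f: "smooth \<beta> f"
    and range_f: "\<And>y z. f y - f z \<le> M"
    and sets_\<U>: "\<And>t. t \<in> {1..T} \<Longrightarrow> decision_set (\<U> t)"
    and meas_\<rho>: "\<And>t. t \<in> {1..T} \<Longrightarrow> \<rho> t \<in> measurable P R"
    and meas_s: "\<And>t. t \<in> {1..T} \<Longrightarrow> s t \<in> borel_measurable P"
    and meas_U: "\<And>t. t \<in> {1..T} \<Longrightarrow> U t \<in> borel_measurable P"
    and run: "\<And>\<omega>. \<omega> \<in> space P \<Longrightarrow>
        conversion_run M \<beta> \<sigma> T \<U> \<A> x1 (\<lambda>t. \<rho> t \<omega>) (\<lambda>t. s t \<omega>)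
          (\<lambda>t. x t \<omega>) (\<lambda>t. m t \<omega>) (\<lambda>t. U t \<omega>)"
    and fresh: "\<And>t. t \<in> {1..T} \<Longrightarrow>
        unbiased_bounded_variance P (history P R \<rho> s x m U t) \<sigma> (s t) (\<lambda>\<omega>. grad f (x t \<omega>))"
begin

section \<open>Parameters and pathwise bounds\<close>

abbreviation "G \<equiv> par_G M \<beta>"
abbreviation "G0 \<equiv> par_G0 M \<beta>"
abbreviation "a \<equiv> par_a M \<beta> \<sigma> T"
abbreviation "\<eta> \<equiv> par_eta M \<beta> \<sigma> T"
abbreviation "H \<equiv> history P R \<rho> s x m U"

definition g :: "nat \<Rightarrow> 'w \<Rightarrow> real^'n" where "g t \<omega> = grad f (x t \<omega>)"

lemma G_pos: "G > 0"
  using \<beta> M by (simp add: par_G_def)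

lemma G_sq: "G\<^sup>2 = M * \<beta>"
  using \<beta> M by (simp add: par_G_def)

lemma G0_pos: "G0 > 0"
  using \<beta> M by (simp add: par_G0_def)

lemma G0_sq: "G0\<^sup>2 = 2 * M * \<beta>"
  using \<beta> M by (simp add: par_G0_def)

lemma a_pos: "a > 0"
  using G_pos by (auto simp: par_a_def less_max_iff_disj)

lemma a_le_1: "a \<le> 1"
  using G_pos by (auto simp: par_a_def less_max_iff_disj divide_le_eq)

text \<open>The maximum in \<open>par_a\<close> is at most the sum of its arguments. This limits the
  terms that grow like \<open>M * \<beta> / a\<close>.\<close>

lemma inverse_a_le: "1 / a \<le> 1 + \<sigma> * sqrt T / G"
proof -
  have "max G (\<sigma> * sqrt T) \<le> G + \<sigma> * sqrt T" using G_pos \<sigma> by simp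
  then have "max G (\<sigma> * sqrt T) / G \<le> (G + \<sigma> * sqrt T) / G"
    using G_pos by (intro divide_right_mono) auto
  then show ?thesis using G_pos by (simp add: par_a_def add_divide_distrib)
qed

text \<open>The maximum in \<open>par_a\<close> is at least its second argument. This limits the
  accumulated noise \<open>a * \<sigma>\<^sup>2 * T\<close>.\<close>

lemma a_noise_le: "a * (\<sigma> * sqrt T) \<le> G"
  using G_pos by (simp add: par_a_def divide_le_eq less_max_iff_disj)

lemma eta_pos: "\<eta> > 0"
  using a_pos \<beta> by (simp add: par_eta_def)

text \<open>This is the factor by which the gradient can drift in one round, relative to the norm of
  the momentum.\<close>

lemma beta_eta: "\<beta> * \<eta> = a / 64"
  using \<beta> by (simp add: par_eta_def)

lemma init: "\<omega> \<in> space P \<Longrightarrow> x 1 \<omega> = x1" "\<omega> \<in> space P \<Longrightarrow> m 1 \<omega> = 0"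
  using run by (auto simp: conversion_run_def)

lemma step:
  assumes "\<omega> \<in> space P" "t \<in> {1..T}"
  shows step_U: "U t \<omega> \<in> \<U> t"
    and step_x: "x (Suc t) \<omega> = x t \<omega> - \<eta> *\<^sub>R (U t \<omega> *v m t \<omega>)"
    and step_m: "m (Suc t) \<omega> = closest_point (cball 0 G0) ((1 - a) *\<^sub>R m t \<omega> + a *\<^sub>R s t \<omega>)"
  using run[OF assms(1)] assms(2) unfolding conversion_run_def Suc_eq_plus1 by blast+

lemma norm_U_mult_le:
  assumes "\<omega> \<in> space P" "t \<in> {1..T}"
  shows "norm (U t \<omega> *v v) \<le> norm v"
  using decision_set_norm_le[OF sets_\<U> step_U] assms by blast

lemma norm_m_le:
  assumes "\<omega> \<in> space P" "t \<in> {1..Suc T}"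
  shows "norm (m t \<omega>) \<le> G0"
proof (cases "t = 1")
  case True
  then show ?thesis using init assms G0_pos by simp
next
  case False
  then obtain k where k: "t = Suc k" "k \<in> {1..T}" using assms by (cases t) auto
  have "m t \<omega> \<in> cball 0 G0"
    unfolding k(1) step_m[OF assms(1) k(2)]
    using G0_pos by (intro closest_point_in_set) auto
  then show ?thesis by simp
qed

text \<open>The radius \<open>G0\<close> is the a priori gradient bound of a smooth function with
  range \<open>M\<close>, so the projection ball contains every gradient.\<close>

lemma norm_g_le: "norm (g t \<omega>) \<le> G0"
proof (rule power2_le_imp_le)
  show "(norm (g t \<omega>))\<^sup>2 \<le> G0\<^sup>2"
    unfolding g_def G0_sq by (rule norm_grad_le[OF smooth_f \<beta> range_f])
qed (use G0_pos in simp)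

section \<open>Measurability and the history\<close>

lemma borel_measurable_run:
  assumes "t \<in> {1..Suc T}"
  shows "x t \<in> borel_measurable P \<and> m t \<in> borel_measurable P"
proof -
  have "t \<ge> 1" using assms by simp
  then show ?thesis using assms
  proof (induction t rule: dec_induct)
    case base
    have "x 1 \<in> borel_measurable P \<longleftrightarrow> (\<lambda>_. x1) \<in> borel_measurable P"
      "m 1 \<in> borel_measurable P \<longleftrightarrow> (\<lambda>_. 0 :: real^'n) \<in> borel_measurable P"
      by (intro measurable_cong init; assumption)+
    then show ?case by simp
  next
    case (step t)
    then have t: "t \<in> {1..T}" by auto
    have [measurable]: "x t \<in> borel_measurable P" "m t \<in> borel_measurable P"
      "s t \<in> borel_measurable P" "U t \<in> borel_measurable P"
      using step meas_s[OF t] meas_U[OF t] by auto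
    \<comment> \<open>The recursions are known only on \<open>space P\<close>, so measurability is
      transferred by congruence. Projection onto the closed ball is continuous.\<close>
    have "x (Suc t) \<in> borel_measurable P \<longleftrightarrow> (\<lambda>\<omega>. x t \<omega> - \<eta> *\<^sub>R (U t \<omega> *v m t \<omega>)) \<in> borel_measurable P"
      by (intro measurable_cong step_x t; assumption)
    moreover have "m (Suc t) \<in> borel_measurable P \<longleftrightarrow>
        (\<lambda>\<omega>. closest_point (cball 0 G0) ((1 - a) *\<^sub>R m t \<omega> + a *\<^sub>R s t \<omega>)) \<in> borel_measurable P"
      by (intro measurable_cong step_m t; assumption)
    moreover have "(\<lambda>\<omega>. closest_point (cball 0 G0) ((1 - a) *\<^sub>R m t \<omega> + a *\<^sub>R s t \<omega>)) \<in> borel_measurable P"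
      by (rule borel_measurable_continuous_on[OF continuous_on_closest_point])
        (use G0_pos in auto)
    ultimately show ?case by simp
  qed
qed

lemma borel_measurable_grad:
  "v \<in> borel_measurable N \<Longrightarrow> (\<lambda>\<omega>. grad f (v \<omega>)) \<in> borel_measurable N"
  by (rule borel_measurable_continuous_on[OF continuous_on_grad[OF smooth_f \<beta>]])

lemma meas [measurable]:
  "t \<in> {1..Suc T} \<Longrightarrow> x t \<in> borel_measurable P"
  "t \<in> {1..Suc T} \<Longrightarrow> m t \<in> borel_measurable P"
  "t \<in> {1..Suc T} \<Longrightarrow> g t \<in> borel_measurable P"
  using borel_measurable_run borel_measurable_grad unfolding g_def[abs_def] by blast+

lemma history_generators_sets:
  assumes t: "t \<in> {1..T}"
  shows "(\<Union>i\<in>{1..t}. events_of P R (\<rho> i) \<union> events_of P borel (x i) \<union>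
            events_of P borel (m i) \<union> events_of P borel (U i)) \<union>
         (\<Union>i\<in>{1..<t}. events_of P borel (s i)) \<subseteq> sets P"
  using t by (intro Un_least UN_least events_of_subset_sets)
    (auto intro!: meas_\<rho> meas_s meas_U meas(1,2))

lemma history:
  assumes t: "t \<in> {1..T}"
  shows subalgebra_history: "subalgebra P (H t)"
    and x_history: "x t \<in> borel_measurable (H t)"
    and m_history: "m t \<in> borel_measurable (H t)"
    and U_history: "U t \<in> borel_measurable (H t)"
proof -
  let ?E = "(\<Union>i\<in>{1..t}. events_of P R (\<rho> i) \<union> events_of P borel (x i) \<union>
            events_of P borel (m i) \<union> events_of P borel (U i)) \<union>
         (\<Union>i\<in>{1..<t}. events_of P borel (s i))"
  \<comment> \<open>The generators must be subsets of the space for \<open>sigma\<close> to denote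
    the sigma-algebra they generate.\<close>
  have E: "?E \<subseteq> Pow (space P)"
    using history_generators_sets[OF t] sets.space_closed by blast
  then have space: "space (H t) = space P" and sets: "sets (H t) = sigma_sets (space P) ?E"
    by (simp_all add: history_def space_measure_of_conv)
  show "subalgebra P (H t)"
    using sets.sigma_sets_subset[OF history_generators_sets[OF t]]
    by (simp add: subalgebra_def space sets)
  have *: "X \<in> borel_measurable (H t)" if "events_of P borel X \<subseteq> ?E" for X :: "'w \<Rightarrow> 'c::topological_space"
  proof (rule measurableI)
    fix A :: "'c set" assume "A \<in> sets borel"
    then have "X -` A \<inter> space P \<in> ?E" using that unfolding events_of_def by blast
    then show "X -` A \<inter> space (H t) \<in> sets (H t)"
      unfolding space sets by (rule sigma_sets.Basic)
  qed simp
  show "x t \<in> borel_measurable (H t)" "m t \<in> borel_measurable (H t)" "U t \<in> borel_measurable (H t)"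
    using t by (auto intro!: *)
qed

lemma g_history: "t \<in> {1..T} \<Longrightarrow> g t \<in> borel_measurable (H t)"
  using borel_measurable_grad[OF x_history] by (simp add: g_def[abs_def])

text \<open>The update of \<open>x\<close> uses \<open>x t\<close>, \<open>m t\<close> and
  \<open>U t\<close> but not the sample \<open>s t\<close>, so the next gradient is already
  determined before \<open>s t\<close> is drawn.\<close>

lemma g_Suc_history:
  assumes t: "t \<in> {1..T}"
  shows "g (Suc t) \<in> borel_measurable (H t)"
proof -
  have [measurable]: "x t \<in> borel_measurable (H t)" "m t \<in> borel_measurable (H t)" "U t \<in> borel_measurable (H t)"
    using history[OF t] by auto
  have space: "space (H t) = space P"
    using subalgebra_history[OF t] by (simp add: subalgebra_def)
  have "x (Suc t) \<in> borel_measurable (H t) \<longleftrightarrow> (\<lambda>\<omega>. x t \<omega> - \<eta> *\<^sub>R (U t \<omega> *v m t \<omega>)) \<in> borel_measurable (H t)"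
    by (intro measurable_cong step_x t) (simp add: space)
  then have "x (Suc t) \<in> borel_measurable (H t)" by simp
  then show ?thesis using borel_measurable_grad by (simp add: g_def[abs_def])
qed

lemma fresh': "t \<in> {1..T} \<Longrightarrow> unbiased_bounded_variance P (H t) \<sigma> (s t) (g t)"
  using fresh by (simp add: g_def[abs_def])

section \<open>Second moments, the regret identity and the summed inequalities\<close>

definition "Eg t = (\<integral>\<omega>. (norm (g t \<omega>))\<^sup>2 \<partial>P)"
definition "Em t = (\<integral>\<omega>. (norm (m t \<omega>))\<^sup>2 \<partial>P)"
definition "Ee t = (\<integral>\<omega>. (norm (m t \<omega> - g t \<omega>))\<^sup>2 \<partial>P)"
definition "Egm t = (\<integral>\<omega>. m t \<omega> \<bullet> g t \<omega> \<partial>P)"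
definition "EgUm t = (\<integral>\<omega>. (U t \<omega> *v m t \<omega>) \<bullet> g t \<omega> \<partial>P)"

lemma norm_e_le: "\<omega> \<in> space P \<Longrightarrow> t \<in> {1..Suc T} \<Longrightarrow> norm (m t \<omega> - g t \<omega>) \<le> 2 * G0"
  using norm_triangle_ineq4[of "m t \<omega>" "g t \<omega>"] norm_m_le[of \<omega> t] norm_g_le[of t \<omega>] by linarith

lemma norm_Um_le: "\<omega> \<in> space P \<Longrightarrow> t \<in> {1..T} \<Longrightarrow> norm (U t \<omega> *v m t \<omega>) \<le> G0"
  using order_trans[OF norm_U_mult_le norm_m_le] by auto

lemma integrable_run:
  assumes t: "t \<in> {1..Suc T}"
  shows "integrable P (\<lambda>\<omega>. (norm (g t \<omega>))\<^sup>2)" "integrable P (\<lambda>\<omega>. (norm (m t \<omega>))\<^sup>2)"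
    "integrable P (\<lambda>\<omega>. (norm (m t \<omega> - g t \<omega>))\<^sup>2)" "integrable P (\<lambda>\<omega>. m t \<omega> \<bullet> g t \<omega>)"
proof -
  note [measurable] = meas[OF t]
  show "integrable P (\<lambda>\<omega>. (norm (g t \<omega>))\<^sup>2)"
    by (rule integrable_norm_sq[OF _ norm_g_le]) measurable
  show "integrable P (\<lambda>\<omega>. (norm (m t \<omega>))\<^sup>2)"
    by (rule integrable_norm_sq[OF _ norm_m_le[OF _ t]]) measurable
  show "integrable P (\<lambda>\<omega>. (norm (m t \<omega> - g t \<omega>))\<^sup>2)"
    by (rule integrable_norm_sq[OF _ norm_e_le[OF _ t]]) measurable
  show "integrable P (\<lambda>\<omega>. m t \<omega> \<bullet> g t \<omega>)"
    by (rule integrable_inner_bounded[OF _ _ norm_m_le[OF _ t] norm_g_le]) measurable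
qed

lemma meas_Um:
  assumes t: "t \<in> {1..T}"
  shows "(\<lambda>\<omega>. U t \<omega> *v m t \<omega>) \<in> borel_measurable P"
  using meas(2)[of t] meas_U[OF t] t by (intro borel_measurable_matrix_vector_mult) auto

lemma integrable_Um:
  assumes t: "t \<in> {1..T}"
  shows "integrable P (\<lambda>\<omega>. (U t \<omega> *v m t \<omega>) \<bullet> g t \<omega>)"
  using meas_Um meas(3)[of t] t
  by (intro integrable_inner_bounded[OF _ _ norm_Um_le norm_g_le]) auto

lemma polarization:
  assumes t: "t \<in> {1..T}"
  shows "2 * Egm t = Eg t + Em t - Ee t"
proof -
  have t': "t \<in> {1..Suc T}" using t by auto
  have "2 * Egm t = (\<integral>\<omega>. 2 * (g t \<omega> \<bullet> m t \<omega>) \<partial>P)"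
    by (simp add: Egm_def inner_commute)
  also have "\<dots> = Eg t + Em t - Ee t"
    unfolding inner_eq_norm_sq_diff Eg_def Em_def Ee_def
    using integrable_run[OF t'] by simp
  finally show ?thesis .
qed

lemma Eg_le: "t \<in> {1..T} \<Longrightarrow> Eg t \<le> 2 * Em t + 2 * Ee t"
proof -
  assume t: "t \<in> {1..T}"
  have "Eg t \<le> (\<integral>\<omega>. 2 * (norm (m t \<omega>))\<^sup>2 + 2 * (norm (m t \<omega> - g t \<omega>))\<^sup>2 \<partial>P)"
    unfolding Eg_def using integrable_run[of t] t by (intro integral_mono norm_sq_le_twice) auto
  then show ?thesis using integrable_run[of t] t unfolding Em_def Ee_def by simp
qed

text \<open>The vectors \<open>m t\<close> and \<open>U t *v m t\<close> are bounded and known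
  before \<open>s t\<close> is drawn, so in expectation the sample may be replaced by the gradient
  in both losses. The factor \<open>G\<close> cancels the scaling of the loss.\<close>

lemma regret_eq: "G * expected_regret P M \<beta> T s m U (mat 1) = (\<Sum>t=1..T. Egm t - EgUm t)"
proof -
  have *: "integrable P (\<lambda>\<omega>. m t \<omega> \<bullet> s t \<omega>)" "integrable P (\<lambda>\<omega>. (U t \<omega> *v m t \<omega>) \<bullet> s t \<omega>)"
    "(\<integral>\<omega>. m t \<omega> \<bullet> s t \<omega> \<partial>P) = Egm t" "(\<integral>\<omega>. (U t \<omega> *v m t \<omega>) \<bullet> s t \<omega> \<partial>P) = EgUm t"
    if t: "t \<in> {1..T}" for t
  proof -
    have t': "t \<in> {1..Suc T}" using t by auto
    \<comment> \<open>These facts instantiate the single-round results with the history as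
      \<open>F\<close>, and with \<open>G0\<close> as the bound on the gradient.\<close>
    note noise = prob_space_axioms subalgebra_history[OF t] fresh'[OF t] meas(3)[OF t'] norm_g_le
    show "integrable P (\<lambda>\<omega>. m t \<omega> \<bullet> s t \<omega>)"
      by (rule integrable_inner_sample[OF noise meas(2)[OF t'] norm_m_le[OF _ t']])
    show "integrable P (\<lambda>\<omega>. (U t \<omega> *v m t \<omega>) \<bullet> s t \<omega>)"
      by (rule integrable_inner_sample[OF noise meas_Um[OF t] norm_Um_le[OF _ t]])
    show "(\<integral>\<omega>. m t \<omega> \<bullet> s t \<omega> \<partial>P) = Egm t"
      unfolding Egm_def by (rule integral_inner_sample[OF noise m_history[OF t] norm_m_le[OF _ t']])
    show "(\<integral>\<omega>. (U t \<omega> *v m t \<omega>) \<bullet> s t \<omega> \<partial>P) = EgUm t"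
      unfolding EgUm_def
      by (rule integral_inner_sample[OF noise _ norm_Um_le[OF _ t]])
        (intro borel_measurable_matrix_vector_mult U_history m_history t)
  qed
  have "expected_regret P M \<beta> T s m U (mat 1) =
      (\<integral>\<omega>. (\<Sum>t=1..T. (1 / G) * (m t \<omega> \<bullet> s t \<omega> - (U t \<omega> *v m t \<omega>) \<bullet> s t \<omega>)) \<partial>P)"
    unfolding expected_regret_def lin_loss_def
    by (simp add: inner_commute sum_subtractf[symmetric] diff_divide_distrib)
  also have "\<dots> = (\<Sum>t=1..T. (1 / G) * (Egm t - EgUm t))"
    using * by (subst Bochner_Integration.integral_sum) auto
  finally show ?thesis using G_pos by (simp add: sum_distrib_left)
qed

text \<open>The descent lemma telescopes along each sample path and the total decrease is at most
  \<open>M\<close>; integration comes afterwards.\<close>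

lemma descent_sum: "(\<Sum>t=1..T. EgUm t) \<le> M / \<eta> + a / 128 * (\<Sum>t=1..T. Em t)"
proof -
  have bound: "(\<Sum>t=1..T. (U t \<omega> *v m t \<omega>) \<bullet> g t \<omega>) \<le> M / \<eta> + a / 128 * (\<Sum>t=1..T. (norm (m t \<omega>))\<^sup>2)"
    if w: "\<omega> \<in> space P" for \<omega>
  proof -
    have "\<eta> * ((U t \<omega> *v m t \<omega>) \<bullet> g t \<omega>) \<le> f (x t \<omega>) - f (x (Suc t) \<omega>) + \<eta> * (a / 128 * (norm (m t \<omega>))\<^sup>2)"
      if t: "t \<in> {1..T}" for t
    proof -
      let ?d = "- \<eta> *\<^sub>R (U t \<omega> *v m t \<omega>)"
      have "f (x (Suc t) \<omega>) \<le> f (x t \<omega>) + g t \<omega> \<bullet> ?d + \<beta> / 2 * (norm ?d)\<^sup>2"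
        using smooth_descent[OF smooth_f, of "x t \<omega>" ?d] step_x[OF w t] by (simp add: g_def)
      also have "(norm ?d)\<^sup>2 \<le> (\<eta> * norm (m t \<omega>))\<^sup>2"
        using eta_pos norm_U_mult_le[OF w t] by (intro power_mono) (auto intro!: mult_left_mono)
      \<comment> \<open>One factor \<open>\<eta>\<close> is kept for the final division; the rest
        becomes \<open>a / 128\<close> since \<open>\<beta> * \<eta> = a / 64\<close>.\<close>
      also have "\<beta> / 2 * (\<eta> * norm (m t \<omega>))\<^sup>2 = \<eta> * (\<beta> * \<eta>) / 2 * (norm (m t \<omega>))\<^sup>2"
        by (simp add: power2_eq_square)
      finally show ?thesis using \<beta> by (simp add: beta_eta inner_commute)
    qed
    then have "(\<Sum>t=1..T. \<eta> * ((U t \<omega> *v m t \<omega>) \<bullet> g t \<omega>)) \<le>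
        (\<Sum>t=1..T. f (x t \<omega>) - f (x (Suc t) \<omega>) + \<eta> * (a / 128 * (norm (m t \<omega>))\<^sup>2))"
      by (rule sum_mono)
    also have "\<dots> = f (x 1 \<omega>) - f (x (Suc T) \<omega>) + \<eta> * (a / 128 * (\<Sum>t=1..T. (norm (m t \<omega>))\<^sup>2))"
      \<comment> \<open>The telescoping rule treats increments, so it is applied to the negated
        objective to obtain decreases.\<close>
      using T sum_Suc_diff[of 1 T "\<lambda>t. - f (x t \<omega>)"]
      by (simp add: sum.distrib sum_distrib_left)
    also have "\<dots> \<le> M + \<eta> * (a / 128 * (\<Sum>t=1..T. (norm (m t \<omega>))\<^sup>2))"
      using range_f by simp
    finally have "\<eta> * (\<Sum>t=1..T. (U t \<omega> *v m t \<omega>) \<bullet> g t \<omega>) \<le> \<eta> * (M / \<eta> + a / 128 * (\<Sum>t=1..T. (norm (m t \<omega>))\<^sup>2))"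
      using eta_pos by (simp add: sum_distrib_left distrib_left)
    then show ?thesis using eta_pos by simp
  qed
  have Em': "integrable P (\<lambda>\<omega>. (norm (m t \<omega>))\<^sup>2)" if "t \<in> {1..T}" for t
    using integrable_run that by simp
  have "(\<Sum>t=1..T. EgUm t) = (\<integral>\<omega>. (\<Sum>t=1..T. (U t \<omega> *v m t \<omega>) \<bullet> g t \<omega>) \<partial>P)"
    unfolding EgUm_def by (rule Bochner_Integration.integral_sum[symmetric]) (rule integrable_Um)
  also have "\<dots> \<le> (\<integral>\<omega>. M / \<eta> + a / 128 * (\<Sum>t=1..T. (norm (m t \<omega>))\<^sup>2) \<partial>P)"
  proof (rule integral_mono)
    show "integrable P (\<lambda>\<omega>. \<Sum>t=1..T. (U t \<omega> *v m t \<omega>) \<bullet> g t \<omega>)"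
      by (rule Bochner_Integration.integrable_sum) (rule integrable_Um)
    show "integrable P (\<lambda>\<omega>. M / \<eta> + a / 128 * (\<Sum>t=1..T. (norm (m t \<omega>))\<^sup>2))"
      by (intro Bochner_Integration.integrable_add integrable_mult_right Bochner_Integration.integrable_sum Em' integrable_const)
  qed (rule bound)
  also have "\<dots> = M / \<eta> + a / 128 * (\<integral>\<omega>. (\<Sum>t=1..T. (norm (m t \<omega>))\<^sup>2) \<partial>P)"
    by (subst Bochner_Integration.integral_add[OF integrable_const integrable_mult_right[OF Bochner_Integration.integrable_sum[OF Em']]])
      (simp_all only: lebesgue_integral_const prob_space integral_mult_right_zero scaleR_one)
  also have "(\<integral>\<omega>. (\<Sum>t=1..T. (norm (m t \<omega>))\<^sup>2) \<partial>P) = (\<Sum>t=1..T. Em t)"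
    unfolding Em_def by (rule Bochner_Integration.integral_sum) (rule Em')
  finally show ?thesis .
qed

text \<open>Before projection the new error splits into a part \<open>h\<close> fixed by the history
  and the centred noise \<open>a *\<^sub>R (s t - g t)\<close>. The part \<open>h\<close> combines
  the damped old error with the drift of the gradient.\<close>

lemma error_step:
  assumes t: "t \<in> {1..T}"
  shows "Ee (Suc t) \<le> (1 - a) * Ee t + a / 4096 * Em t + a\<^sup>2 * \<sigma>\<^sup>2"
proof -
  have t': "t \<in> {1..Suc T}" "Suc t \<in> {1..Suc T}" using t by auto
  define h where "h \<omega> = (1 - a) *\<^sub>R (m t \<omega> - g t \<omega>) + (g t \<omega> - g (Suc t) \<omega>)" for \<omega>
  have h_meas: "h \<in> borel_measurable (H t)"
    using m_history[OF t] g_history[OF t] g_Suc_history[OF t] unfolding h_def[abs_def] by measurable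
  have h_sq: "(norm (h \<omega>))\<^sup>2 \<le> (1 - a) * (norm (m t \<omega> - g t \<omega>))\<^sup>2 + a / 4096 * (norm (m t \<omega>))\<^sup>2"
    if w: "\<omega> \<in> space P" for \<omega>
  proof -
    have "norm (g t \<omega> - g (Suc t) \<omega>) \<le> \<beta> * norm (x t \<omega> - x (Suc t) \<omega>)"
      using smooth_f by (simp add: smooth_def g_def)
    also have "\<dots> = \<beta> * \<eta> * norm (U t \<omega> *v m t \<omega>)"
      using step_x[OF w t] eta_pos by simp
    also have "\<dots> \<le> a / 64 * norm (m t \<omega>)"
      unfolding beta_eta using a_pos by (intro mult_left_mono norm_U_mult_le w t) auto
    finally have "(norm (g t \<omega> - g (Suc t) \<omega>))\<^sup>2 \<le> (a / 64 * norm (m t \<omega>))\<^sup>2"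
      by (intro power_mono) auto
    then have "(norm (g t \<omega> - g (Suc t) \<omega>))\<^sup>2 / a \<le> (a / 64 * norm (m t \<omega>))\<^sup>2 / a"
      using a_pos by (intro divide_right_mono) auto
    \<comment> \<open>The constant is the square of 64: the drift is at most \<open>a / 64\<close>
      times the momentum norm, and one factor \<open>a\<close> is lost to the division.\<close>
    also have "\<dots> = a / 4096 * (norm (m t \<omega>))\<^sup>2"
      using a_pos by (simp add: power2_eq_square)
    finally show ?thesis
      using norm_convex_combination_sq_le[OF a_pos a_le_1, of "m t \<omega> - g t \<omega>" "g t \<omega> - g (Suc t) \<omega>"]
      unfolding h_def by linarith
  qed
  \<comment> \<open>This crude bound serves only integrability.\<close>
  have h_le: "norm (h \<omega>) \<le> 4 * G0" if w: "\<omega> \<in> space P" for \<omega>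
  proof -
    have "norm (h \<omega>) \<le> (1 - a) * norm (m t \<omega> - g t \<omega>) + norm (g t \<omega> - g (Suc t) \<omega>)"
      using norm_triangle_ineq[of "(1 - a) *\<^sub>R (m t \<omega> - g t \<omega>)" "g t \<omega> - g (Suc t) \<omega>"] a_le_1
      by (simp add: h_def)
    also have "\<dots> \<le> 1 * (2 * G0) + 2 * G0"
      using a_pos a_le_1 norm_e_le[OF w t'(1)] norm_g_le[of t \<omega>] norm_g_le[of "Suc t" \<omega>]
        norm_triangle_ineq4[of "g t \<omega>" "g (Suc t) \<omega>"]
      by (intro add_mono mult_mono) auto
    finally show ?thesis by simp
  qed
  \<comment> \<open>The gradient \<open>g (Suc t)\<close> lies in the ball and is its own
    projection; projection is 1-Lipschitz, so it cannot increase the distance to this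
    gradient.\<close>
  have contract: "norm (m (Suc t) \<omega> - g (Suc t) \<omega>) \<le> norm (h \<omega> + a *\<^sub>R (s t \<omega> - g t \<omega>))"
    if w: "\<omega> \<in> space P" for \<omega>
  proof -
    let ?y = "(1 - a) *\<^sub>R m t \<omega> + a *\<^sub>R s t \<omega>"
    have "g (Suc t) \<omega> \<in> cball 0 G0" using norm_g_le by simp
    then have "closest_point (cball 0 G0) (g (Suc t) \<omega>) = g (Suc t) \<omega>"
      by (rule closest_point_self)
    then have "norm (m (Suc t) \<omega> - g (Suc t) \<omega>) \<le> norm (?y - g (Suc t) \<omega>)"
      using closest_point_lipschitz[of "cball 0 G0" ?y "g (Suc t) \<omega>"] G0_pos step_m[OF w t]
      by (simp add: dist_norm)
    also have "?y - g (Suc t) \<omega> = h \<omega> + a *\<^sub>R (s t \<omega> - g t \<omega>)"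
      by (simp add: h_def algebra_simps)
    finally show ?thesis .
  qed
  note noise = prob_space_axioms subalgebra_history[OF t] fresh'[OF t] meas(3)[OF t'(1)] norm_g_le h_meas h_le
  have "Ee (Suc t) \<le> (\<integral>\<omega>. (norm (h \<omega> + a *\<^sub>R (s t \<omega> - g t \<omega>)))\<^sup>2 \<partial>P)"
    unfolding Ee_def
    by (intro integral_mono integrable_run t' integral_add_noise_sq_le(1)[OF noise] power_mono contract) auto
  also have "\<dots> \<le> (\<integral>\<omega>. (norm (h \<omega>))\<^sup>2 \<partial>P) + a\<^sup>2 * \<sigma>\<^sup>2"
    by (rule integral_add_noise_sq_le(2)[OF noise])
  also have "(\<integral>\<omega>. (norm (h \<omega>))\<^sup>2 \<partial>P) \<le>
      (\<integral>\<omega>. (1 - a) * (norm (m t \<omega> - g t \<omega>))\<^sup>2 + a / 4096 * (norm (m t \<omega>))\<^sup>2 \<partial>P)"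
    using measurable_from_subalg[OF subalgebra_history[OF t] h_meas] integrable_run[OF t'(1)]
    by (intro integral_mono integrable_norm_sq[OF _ h_le] h_sq) auto
  also have "\<dots> = (1 - a) * Ee t + a / 4096 * Em t"
    using integrable_run[OF t'(1)] by (simp add: Ee_def Em_def)
  finally show ?thesis by simp
qed

text \<open>The contraction by \<open>1 - a\<close> bounds \<open>a * Ee t\<close> by a telescoping
  difference plus source terms; dividing the sum by \<open>a\<close> gives the claim.\<close>

lemma error_sum: "(\<Sum>t=1..T. Ee t) \<le> 2 * M * \<beta> / a + (\<Sum>t=1..T. Em t) / 4096 + a * \<sigma>\<^sup>2 * T"
proof -
  have "a * Ee t \<le> Ee t - Ee (Suc t) + (a / 4096 * Em t + a\<^sup>2 * \<sigma>\<^sup>2)" if "t \<in> {1..T}" for t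
    using error_step[OF that] by (simp add: algebra_simps)
  then have "(\<Sum>t=1..T. a * Ee t) \<le> (\<Sum>t=1..T. Ee t - Ee (Suc t) + (a / 4096 * Em t + a\<^sup>2 * \<sigma>\<^sup>2))"
    by (rule sum_mono)
  also have "\<dots> = Ee 1 - Ee (Suc T) + (a / 4096 * (\<Sum>t=1..T. Em t) + T * (a\<^sup>2 * \<sigma>\<^sup>2))"
    using T sum_Suc_diff[of 1 T "\<lambda>t. - Ee t"] by (simp add: sum.distrib sum_distrib_left)
  also have "\<dots> \<le> 2 * M * \<beta> + (a / 4096 * (\<Sum>t=1..T. Em t) + T * (a\<^sup>2 * \<sigma>\<^sup>2))"
  proof -
    \<comment> \<open>Since \<open>m 1 = 0\<close>, the initial error is the norm of the first
      gradient.\<close>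
    have "Ee 1 \<le> (\<integral>\<omega>. G0\<^sup>2 \<partial>P)"
      unfolding Ee_def using init norm_g_le integrable_run(3)[of 1]
      by (intro integral_mono) (auto intro!: power_mono)
    moreover have "Ee (Suc T) \<ge> 0" by (simp add: Ee_def)
    ultimately show ?thesis by (simp add: prob_space G0_sq)
  qed
  also have "\<dots> = a * (2 * M * \<beta> / a + (\<Sum>t=1..T. Em t) / 4096 + a * \<sigma>\<^sup>2 * T)"
    using a_pos by (simp add: distrib_left power2_eq_square mult_ac)
  finally show ?thesis using a_pos by (simp add: sum_distrib_left[symmetric])
qed

lemma gradient_sum_le:
  "(\<Sum>t=1..T. Eg t) \<le> 101 * \<sigma> * G * sqrt T
     + 8192 / 5951 * (G * expected_regret P M \<beta> T s m U (mat 1)) + 97 * (M * \<beta>)"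
proof -
  define Sg Sm Se where "Sg = (\<Sum>t=1..T. Eg t)" and "Sm = (\<Sum>t=1..T. Em t)" and "Se = (\<Sum>t=1..T. Ee t)"
  define GR where "GR = G * expected_regret P M \<beta> T s m U (mat 1)"
  define V where "V = M * \<beta> / a"
  define W where "W = a * \<sigma>\<^sup>2 * T"
  have "2 * (\<Sum>t=1..T. Egm t) = Sg + Sm - Se"
    unfolding Sg_def Sm_def Se_def
    by (simp add: sum_distrib_left polarization sum.distrib sum_subtractf)
  moreover have "GR = (\<Sum>t=1..T. Egm t) - (\<Sum>t=1..T. EgUm t)"
    unfolding GR_def regret_eq by (simp add: sum_subtractf)
  moreover have "M / \<eta> = 64 * V"
    by (simp add: V_def par_eta_def)
  moreover have "Sm \<ge> 0"
    unfolding Sm_def Em_def by (intro sum_nonneg) simp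
  moreover from this have "a / 128 * Sm \<le> 1 / 128 * Sm"
    using a_le_1 by (intro mult_right_mono) auto
  \<comment> \<open>The polarization identity carries a factor 2, so the regret identity and the
    descent bound enter doubled: \<open>2 * 64 * V\<close> and \<open>2 * Sm / 128\<close>.\<close>
  ultimately have 1: "Sg + Sm - Se \<le> 128 * V + Sm / 64 + 2 * GR"
    using descent_sum unfolding Sm_def[symmetric] by linarith
  have 2: "Se \<le> 2 * V + Sm / 4096 + W"
    using error_sum by (simp add: Se_def Sm_def V_def W_def)
  have 3: "Sg \<le> 2 * Sm + 2 * Se"
    unfolding Sg_def Sm_def Se_def sum_distrib_left sum.distrib[symmetric] by (rule sum_mono) (rule Eg_le)
  have V: "V \<le> M * \<beta> + \<sigma> * G * sqrt T"
  proof -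
    have "V \<le> G\<^sup>2 * (1 + \<sigma> * sqrt T / G)"
      \<comment> \<open>Writing \<open>M * \<beta>\<close> as \<open>G\<^sup>2\<close> lets one
        factor \<open>G\<close> cancel the denominator in the bound on \<open>1 / a\<close>.\<close>
      unfolding V_def G_sq using inverse_a_le \<beta> M mult_left_mono[of "1 / a" _ "M * \<beta>"] by simp
    also have "\<dots> = G\<^sup>2 + \<sigma> * G * sqrt T"
      using G_pos by (simp add: distrib_left power2_eq_square)
    finally show ?thesis by (simp add: G_sq)
  qed
  have W: "W \<le> \<sigma> * G * sqrt T"
  proof -
    have "W = (a * (\<sigma> * sqrt T)) * (\<sigma> * sqrt T)"
      by (simp add: W_def power2_eq_square)
    also have "\<dots> \<le> G * (\<sigma> * sqrt T)"
      using a_noise_le \<sigma> by (intro mult_right_mono) auto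
    finally show ?thesis by (simp add: mult_ac)
  qed
  have "0 \<le> \<sigma> * G * sqrt T" "0 \<le> M * \<beta>" using \<sigma> G_pos \<beta> M by auto
  \<comment> \<open>Weights \<open>4096\<close>, \<open>7806 = 4096 + 2 * 1855\<close> and \<open>1855 = 5951 - 4096\<close> on facts 1, 2 and 3.\<close>
  with 1 2 3 V W \<open>Sm \<ge> 0\<close> have "Sg \<le> 101 * (\<sigma> * G * sqrt T) + 8192 / 5951 * GR + 97 * (M * \<beta>)"
    by linarith
  then show ?thesis by (simp add: Sg_def GR_def mult.assoc)
qed

end

theorem mainTheorem1:
  fixes f :: "real^'n \<Rightarrow> real" and \<beta> M \<sigma> :: real and T :: nat
    and \<U> :: "nat \<Rightarrow> (real^'n^'n) set"
    and \<A> :: "'r list \<Rightarrow> (real^'n^'n \<Rightarrow> real) list \<Rightarrow> real^'n^'n"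
    and P :: "'w measure" and R :: "'r measure"
    and \<rho> :: "nat \<Rightarrow> 'w \<Rightarrow> 'r"
    and s x m :: "nat \<Rightarrow> 'w \<Rightarrow> real^'n" and U :: "nat \<Rightarrow> 'w \<Rightarrow> real^'n^'n"
    and x1 :: "real^'n"
  assumes "\<beta> > 0" and "M > 0" and "\<sigma> \<ge> 0" and "T \<ge> 1"
    and smooth_f: "smooth \<beta> f"
    and range_f: "\<And>y z. f y - f z \<le> M"
    and sets_\<U>: "\<And>t. t \<in> {1..T} \<Longrightarrow> decision_set (\<U> t)"
    and prob: "prob_space P"
    and meas_\<rho>: "\<And>t. t \<in> {1..T} \<Longrightarrow> \<rho> t \<in> measurable P R"
    and meas_s: "\<And>t. t \<in> {1..T} \<Longrightarrow> s t \<in> borel_measurable P"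
    and meas_U: "\<And>t. t \<in> {1..T} \<Longrightarrow> U t \<in> borel_measurable P"
    and run: "\<And>\<omega>. \<omega> \<in> space P \<Longrightarrow>
        conversion_run M \<beta> \<sigma> T \<U> \<A> x1 (\<lambda>t. \<rho> t \<omega>) (\<lambda>t. s t \<omega>)
          (\<lambda>t. x t \<omega>) (\<lambda>t. m t \<omega>) (\<lambda>t. U t \<omega>)"
    and fresh: "\<And>t. t \<in> {1..T} \<Longrightarrow>
        unbiased_bounded_variance P (history P R \<rho> s x m U t) \<sigma> (s t) (\<lambda>\<omega>. grad f (x t \<omega>))"
  shows "1 / real T * (\<Sum>t=1..T. (\<integral>\<omega>. (norm (grad f (x t \<omega>)))\<^sup>2 \<partial>P))
      \<le> 101 * \<sigma> * sqrt (M * \<beta>) / sqrt (real T)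
        + 8192 / 5951 * (sqrt (M * \<beta>) * expected_regret P M \<beta> T s m U (mat 1) / real T)
        + 97 * M * \<beta> / real T"
proof -
  interpret conversion P f \<beta> M \<sigma> T \<U> \<A> R \<rho> s x m U x1
    by (intro conversion.intro conversion_axioms.intro prob) (use assms in auto)
  let ?Reg = "expected_regret P M \<beta> T s m U (mat 1)"
  have "(\<Sum>t=1..T. (\<integral>\<omega>. (norm (grad f (x t \<omega>)))\<^sup>2 \<partial>P)) / T \<le>
      (101 * \<sigma> * G * sqrt T + 8192 / 5951 * (G * ?Reg) + 97 * (M * \<beta>)) / T"
    using gradient_sum_le by (intro divide_right_mono) (simp_all add: Eg_def g_def)
  also have "\<dots> = 101 * \<sigma> * G * (sqrt T / T) + 8192 / 5951 * (G * ?Reg / T) + 97 * M * \<beta> / T"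
    by (simp add: add_divide_distrib)
  also have "sqrt T / T = 1 / sqrt T"
    using \<open>T \<ge> 1\<close> by (simp add: field_simps)
  finally show ?thesis by (simp add: par_G_def)
qed

end
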